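(* Let $\mathcal{PB}_2^h(x,E)$ be the Piterbarg-Berman function with $E=[a,b]$, $a<b$, $a,b\in\mathbb R$, and $x\in[0,b-a]$. (i) If $h(t)+t^2$ is a continuous, convex function on $E$, then $$ \begin{aligned} \mathcal{PB}_2^h(x,E)=&\int_{\mathbb R}e^z\Big[\mathbb P\{f_{\mathcal N}(a)<0,\ f_{\mathcal N}(b)<0\}+\mathbb P\{f_{\mathcal N}(a)>0,\ f_{\mathcal N}(b)>0,\ s_2-s_1>x,\ f_{\mathcal N}(s^* )<0\}\Big]dz\\ &+\int_{\mathbb R}e^z\Big[\mathbb P\{f_{\mathcal N}(a)\le0,\ f_{\mathcal N}(a+x)<0,\ f_{\mathcal N}(b)>0\}+\mathbb P\{f_{\mathcal N}(a)>0,\ f_{\mathcal N}(b-x)<0,\ f_{\mathcal N}(b)\le0\}\Big]dz . \end{aligned} $$ (ii) If $h(t)+t^2$, $t\in\mathbb R$, is continuous and convex, and the right derivative $h'_+(a)$ and the left derivative $h'_-(b)$ exist with finite values, then $h'_+(a)\le h'_-(b)$ and $$ \begin{aligned} \mathcal{PB}_2^h(x,E)=&\int_{\mathbb R}e^z\Big[\mathbb P\{f_{\mathcal N}(a+x)<0,\ \sqrt2\mathcal N\le h'_+(a)+2a\}+\mathbb P\{f_{\mathcal N}(b-x)<0,\ \sqrt2\mathcal N\ge h'_-(b)+2b\}\Big]dz\\ &+\int_{\mathbb R}e^z\,\mathbb P\{\min(b,t_2)-\max(a,t_1)>x,\ h'_+(a)+2a<\sqrt2\mathcal N<h'_-(b)+2b,\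 f_{\mathcal N}(t^* )<0\}\,dz . \end{aligned} $$
   Context: Let $\mathcal N\sim N(0,1)$. For an interval $E$ and a drift function $h$ continuous on $E$, the Piterbarg-Berman function (for the fractional Brownian motion $B_2(t)=\mathcal N t$) is $$\mathcal{PB}_2^h(x,E)=\int_{\mathbb R}e^z\,\mathbb P\Big\{\int_E\mathbb I\big(\sqrt2\,\mathcal N t-t^2-h(t)-z>0\big)\,dt>x\Big\}\,dz,\qquad x\in[0,\mathrm{mes}(E)].$$ For $z\in\mathbb R$ put $f_{\mathcal N}(t)=f_{\mathcal N}(t,z)=h(t)+t^2-\sqrt2\,\mathcal N t+z$. In (i), $f_{\mathcal N}(s^* )=\min_{s\in E}f_{\mathcal N}(s)$ and, if $f_{\mathcal N}(s^* )<0$, $s_1<s_2$ are the two random solutions of $f_{\mathcal N}(s)=0$, $s\in E$. In (ii), $f_{\mathcal N}(t^* )=\min_{t\in\mathbb R}f_{\mathcal N}(t)$ and, if $f_{\mathcal N}(t^* )<0$, $t_1<t_2$ are the two random solutions of $f_{\mathcal N}(t)=0$, $t\in\mathbb R$.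
   Formalization: The endpoint x=b-a is excluded, since there the left side is 0 and both right sides are positive; and h'_+(a) ≤ h'_-(b), false for h(t)=-t^2, is replaced by h'_+(a)+2a ≤ h'_-(b)+2b. *)

theory Defs
  imports "HOL-Probability.Probability"
begin

text \<open>
  The drifted parabola for a realisation \<open>y\<close> of the standard normal variable.
\<close>

definition fN :: "(real \<Rightarrow> real) \<Rightarrow> real \<Rightarrow> real \<Rightarrow> real \<Rightarrow> real"
  where "fN h y z t = h t + t\<^sup>2 - sqrt 2 * y * t + z"

text \<open>
  The Piterbarg-Berman function of \<open>B\<^sub>2(t) = N t\<close>.  Both the sojourn time and the outer integral are
  integrals of nonnegative functions and are taken with values in \<open>[0, \<infinity>]\<close>, so no value depends on
  an integrability convention and \<open>E\<close> may be unbounded.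
\<close>

definition PB2 :: "'w measure \<Rightarrow> ('w \<Rightarrow> real) \<Rightarrow> (real \<Rightarrow> real) \<Rightarrow> real \<Rightarrow> real set \<Rightarrow> ennreal"
  where "PB2 M N h x E =
    (\<integral>\<^sup>+ z. ennreal (exp z *
        \<P>(\<omega> in M. (\<integral>\<^sup>+ t\<in>E. indicator {u. sqrt 2 * N \<omega> * u - u\<^sup>2 - h u - z > 0} t \<partial>lborel)
                    > ennreal x))
      \<partial>lborel)"

text \<open>
  The negativity of the attained minimum, without naming a minimiser: it need not exist on an unbounded
  set, and it need not be unique.
\<close>

definition neg_min_on :: "(real \<Rightarrow> real) \<Rightarrow> real set \<Rightarrow> bool"
  where "neg_min_on f E \<longleftrightarrow> (\<exists>s. is_arg_min f (\<lambda>u. u \<in> E) s \<and> f s < 0)"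

definition two_roots_on :: "(real \<Rightarrow> real) \<Rightarrow> real set \<Rightarrow> real \<Rightarrow> real \<Rightarrow> bool"
  where "two_roots_on f E r\<^sub>1 r\<^sub>2 \<longleftrightarrow> r\<^sub>1 < r\<^sub>2 \<and> {s \<in> E. f s = 0} = {r\<^sub>1, r\<^sub>2}"

end

theory Submission
  imports Defs
begin

text \<open>
  Along a fixed realisation \<open>y\<close> of the normal variable, \<open>f = fN h y z\<close> is convex, so the set where it is
  negative is an interval, and the sojourn time exceeds \<open>x\<close> iff \<open>f\<close> is negative at two points of
  \<open>{a..b}\<close> more than \<open>x\<close> apart.  In (i) the signs of \<open>f a\<close> and \<open>f b\<close> reduce this condition to the
  sign of \<open>f\<close> at one point or to the distance of its two roots; the formula can only fail where \<open>f a\<close> or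
  \<open>f b\<close> vanishes, which has probability zero for almost every \<open>z\<close>.  In (ii) the three events say that
  \<open>f\<close> is increasing on \<open>{a..b}\<close>, decreasing there, or decreasing at \<open>a\<close> and increasing at \<open>b\<close>; in
  the last case \<open>f\<close> becomes positive on both sides of \<open>{a..b}\<close> and hence has two roots as soon as it is
  negative somewhere.  The first two events overlap at most in the null event that \<open>sqrt 2 * N\<close> equals
  \<open>da + 2 * a\<close>.
\<close>

definition long_neg :: "(real \<Rightarrow> real) \<Rightarrow> real \<Rightarrow> real \<Rightarrow> real \<Rightarrow> bool"
  where "long_neg f a b x \<longleftrightarrow> (\<exists>u\<in>{a..b}. \<exists>v\<in>{a..b}. u + x < v \<and> f u < 0 \<and> f v < 0)"

section \<open>Sublevel sets of convex functions\<close>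

lemma convex_real_between:
  fixes I :: "real set"
  assumes "convex I" "p \<in> I" "q \<in> I" "p \<le> u" "u \<le> q"
  shows "u \<in> I"
  using assms mem_is_interval_1_I[of I p q u] by (simp add: is_interval_convex_1)

text \<open>Convexity at the weighted mean \<open>u\<close> of \<open>p\<close> and
  \<open>q\<close>, with the denominator \<open>q - p\<close> cleared, so that later sign arguments
  are about sums of products.\<close>

lemma convex_on_real_combination:
  fixes f :: "real \<Rightarrow> real"
  assumes "convex_on I f" "p \<in> I" "q \<in> I" "p < u" "u < q"
  shows "(q - p) * f u \<le> (q - u) * f p + (u - p) * f q"
proof -
  have "convex_on {p..q} f"
    using convex_real_between[OF convex_on_imp_convex[OF assms(1)] assms(2,3)]
    by (intro convex_on_subset[OF assms(1)]) auto
  then have "f u \<le> (f q - f p) / (q - p) * (u - p) + f p"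
    using assms by (intro convex_onD_Icc') auto
  then have "(q - p) * f u \<le> (q - p) * ((f q - f p) / (q - p) * (u - p) + f p)"
    using assms by (intro mult_left_mono) auto
  also have "\<dots> = (f q - f p) * (u - p) + (q - p) * f p"
    using assms by (simp add: distrib_left)
  finally show ?thesis by (simp add: algebra_simps)
qed

text \<open>Since \<open>u\<close> differs from \<open>p\<close>, the negative value
  \<open>f q\<close> has positive weight in the convex combination, so strictness survives even when
  \<open>f p = 0\<close>. The closed segment covers both orders of \<open>p\<close> and
  \<open>q\<close>.\<close>

lemma convex_on_neg_segment:
  fixes f :: "real \<Rightarrow> real"
  assumes "convex_on I f" "p \<in> I" "q \<in> I" "f p \<le> 0" "f q < 0" "u \<in> closed_segment p q" "u \<noteq> p"
  shows "f u < 0"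
proof (cases "u = q")
  case False
  consider "p < u" "u < q" | "q < u" "u < p"
    using assms False by (auto simp: closed_segment_eq_real_ivl split: if_splits)
  then show ?thesis
  proof cases
    case 1
    have "(q - p) * f u \<le> (q - u) * f p + (u - p) * f q"
      using convex_on_real_combination[OF assms(1-3)] 1 by auto
    also have "\<dots> < 0"
      using 1 assms by (intro add_nonpos_neg mult_nonneg_nonpos mult_pos_neg) auto
    finally show ?thesis using 1 by (simp add: mult_less_0_iff)
  next
    case 2
    have "(p - q) * f u \<le> (p - u) * f q + (u - q) * f p"
      using convex_on_real_combination[OF assms(1) assms(3,2)] 2 by auto
    also have "\<dots> < 0"
      using 2 assms by (intro add_neg_nonpos mult_nonneg_nonpos mult_pos_neg) auto
    finally show ?thesis using 2 by (simp add: mult_less_0_iff)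
  qed
qed (use assms in simp)

text \<open>
  The rational form makes \<open>long_neg\<close> jointly measurable in \<open>z\<close> and the realisation, without any
  assumption on \<open>h\<close> off the interval.
\<close>

lemma long_neg_iff_rational:
  assumes "convex_on {a..b} f" "0 \<le> x"
  shows "long_neg f a b x \<longleftrightarrow>
    (\<exists>u\<in>\<rat>. \<exists>v\<in>\<rat>. u \<in> {a..b} \<and> v \<in> {a..b} \<and> u + x < v \<and> f u < 0 \<and> f v < 0)"
    (is "_ \<longleftrightarrow> ?R")
proof
  assume "long_neg f a b x"
  then obtain u v where uv: "u \<in> {a..b}" "v \<in> {a..b}" "u + x < v" "f u < 0" "f v < 0"
    unfolding long_neg_def by blast
  have "u < v" using uv assms by simp
  \<comment> \<open>Moving both ends inward by less than \<open>w\<close> uses up less than the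
    slack \<open>v - (u + x)\<close> and stays between \<open>u\<close> and \<open>v\<close>, where
    convexity keeps \<open>f\<close> negative.\<close>
  define w where "w = min (v - u) (v - (u + x)) / 2"
  have w: "w > 0" "2 * w \<le> v - u" "2 * w \<le> v - (u + x)"
    using \<open>u < v\<close> uv unfolding w_def by auto
  obtain u' where u': "u' \<in> \<rat>" "u < u'" "u' < u + w"
    using Rats_dense_in_real[of u "u + w"] w by auto
  obtain v' where v': "v' \<in> \<rat>" "v - w < v'" "v' < v"
    using Rats_dense_in_real[of "v - w" v] w by auto
  have "f t < 0" if "u < t" "t < v" for t
    using convex_on_neg_segment[OF assms(1) uv(1,2) _ uv(5), of t] uv that
    by (auto simp: closed_segment_eq_real_ivl)
  then show ?R using u' v' w uv
    by (intro bexI[of _ u'] bexI[of _ v']) auto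
qed (unfold long_neg_def, blast)


section \<open>Sojourn time as the width of the sublevel set\<close>

lemma sublevel_measurable:
  fixes f :: "real \<Rightarrow> real"
  assumes "continuous_on {a..b} f"
  shows "{t\<in>{a..b}. f t < 0} \<in> sets lborel"
proof -
  have "closed ({a..b} \<inter> f -` {0..})"
    using assms by (intro continuous_closed_preimage) auto
  moreover have "{t\<in>{a..b}. f t < 0} = {a..b} - ({a..b} \<inter> f -` {0..})"
    by auto
  ultimately show ?thesis by simp
qed

text \<open>If no two negative points are more than \<open>x\<close> apart, the sublevel set lies in
  an interval of length \<open>x\<close> starting at its infimum. Conversely, convexity makes
  \<open>f\<close> negative on the whole segment between two such points.\<close>

lemma sojourn_gt_iff_long_neg:
  assumes convex: "convex_on {a..b} f" and cont: "continuous_on {a..b} f" and "0 \<le> x"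
  shows "emeasure lborel {t\<in>{a..b}. f t < 0} > ennreal x \<longleftrightarrow> long_neg f a b x"
proof
  define S where "S = {t\<in>{a..b}. f t < 0}"
  assume gt: "emeasure lborel {t\<in>{a..b}. f t < 0} > ennreal x"
  show "long_neg f a b x"
  proof (rule ccontr)
    assume not: "\<not> long_neg f a b x"
    have "S \<noteq> {}" using gt unfolding S_def by (metis emeasure_empty not_less_zero)
    have "S \<subseteq> {Inf S..Inf S + x}"
    proof
      fix v assume v: "v \<in> S"
      have "\<not> u + x < v" if "u \<in> S" for u
        using not v that unfolding long_neg_def S_def by blast
      then have "v - x \<le> u" if "u \<in> S" for u
        using that by force
      then have "v - x \<le> Inf S" using \<open>S \<noteq> {}\<close> by (intro cInf_greatest)
      moreover have "bdd_below S" by (auto simp: S_def intro: bdd_belowI[of _ a])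
      then have "Inf S \<le> v" using v by (rule cInf_lower[rotated])
      ultimately show "v \<in> {Inf S..Inf S + x}" by simp
    qed
    then have "emeasure lborel S \<le> emeasure lborel {Inf S..Inf S + x}"
      by (intro emeasure_mono) auto
    then show False using gt \<open>0 \<le> x\<close> by (simp add: S_def)
  qed
next
  assume "long_neg f a b x"
  then obtain u v where uv: "u \<in> {a..b}" "v \<in> {a..b}" "u + x < v" "f u < 0" "f v < 0"
    unfolding long_neg_def by blast
  have "f t < 0" if "t \<in> {u..v}" for t
    using convex_on_neg_segment[OF convex uv(1,2) _ uv(5), of t] uv that \<open>0 \<le> x\<close>
    by (cases "t = u") (auto simp: closed_segment_eq_real_ivl)
  then have "{u..v} \<subseteq> {t\<in>{a..b}. f t < 0}" using uv by auto
  then have "emeasure lborel {u..v} \<le> emeasure lborel {t\<in>{a..b}. f t < 0}"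
    using sublevel_measurable[OF cont] by (rule emeasure_mono)
  moreover have "ennreal x < emeasure lborel {u..v}"
    using uv \<open>0 \<le> x\<close> by (simp add: ennreal_less_iff)
  ultimately show "emeasure lborel {t\<in>{a..b}. f t < 0} > ennreal x" by simp
qed

text \<open>The intermediate value theorem gives a root on each side of \<open>m\<close>. Comparison
  with the negative value at \<open>m\<close> then fixes the sign everywhere else: negative between
  the roots, positive outside.\<close>

lemma convex_on_two_roots:
  fixes f :: "real \<Rightarrow> real"
  assumes convex: "convex_on I f" and cont: "continuous_on I f"
    and I: "p \<in> I" "m \<in> I" "q \<in> I" and "p < m" "m < q"
    and "f p > 0" "f m < 0" "f q > 0"
  obtains r1 r2 where "p < r1" "r2 < q" "two_roots_on f I r1 r2" "{t\<in>I. f t < 0} = {r1<..<r2}"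
proof -
  have mem: "t \<in> I" if "c \<in> I" "d \<in> I" "c \<le> t" "t \<le> d" for c d t
    by (rule convex_real_between[OF convex_on_imp_convex[OF convex] that])
  have "continuous_on {p..m} f" "continuous_on {m..q} f"
    using mem[OF I(1,2)] mem[OF I(2,3)] by (auto intro!: continuous_on_subset[OF cont])
  then have "\<exists>r1\<ge>p. r1 \<le> m \<and> f r1 = 0" "\<exists>r2\<ge>m. r2 \<le> q \<and> f r2 = 0"
    using assms(6-10) by (intro IVT2' IVT'; simp)+
  then obtain r1 r2 where r: "p \<le> r1" "r1 \<le> m" "f r1 = 0" "m \<le> r2" "r2 \<le> q" "f r2 = 0"
    by blast
  have strict: "p < r1" "r1 < m" "m < r2" "r2 < q"
    using r assms(6-10) by (auto simp: order_less_le)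
  have rI: "r1 \<in> I" "r2 \<in> I" using mem[OF I(1,2), of r1] mem[OF I(2,3), of r2] r by auto
  have inside: "f t < 0" if "r1 < t" "t < r2" for t
  proof (cases "t \<le> m")
    case True
    then show ?thesis
      using convex_on_neg_segment[OF convex rI(1) I(2), of t] that r assms(9)
      by (auto simp: closed_segment_eq_real_ivl)
  next
    case False
    then show ?thesis
      using convex_on_neg_segment[OF convex rI(2) I(2), of t] that r assms(9)
      by (auto simp: closed_segment_eq_real_ivl)
  qed
  \<comment> \<open>A nonpositive value beyond a root would, together with \<open>f m < 0\<close>,
    force \<open>f\<close> to be negative at that root.\<close>
  have outside: "f t > 0" if "t \<in> I" "t < r1 \<or> r2 < t" for t
  proof (rule ccontr)
    assume "\<not> f t > 0"
    then have *: "f u < 0" if "u \<in> closed_segment t m" "u \<noteq> t" for u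
      using convex_on_neg_segment[OF convex \<open>t \<in> I\<close> I(2) _ \<open>f m < 0\<close> that] by simp
    show False
      using \<open>t < r1 \<or> r2 < t\<close>
    proof
      assume "t < r1"
      then show False using *[of r1] strict r by (auto simp: closed_segment_eq_real_ivl)
    next
      assume "r2 < t"
      then show False using *[of r2] strict r by (auto simp: closed_segment_eq_real_ivl)
    qed
  qed
  have "t \<in> I \<and> f t < 0 \<longleftrightarrow> r1 < t \<and> t < r2" "t \<in> I \<and> f t = 0 \<longleftrightarrow> t = r1 \<or> t = r2" for t
  proof -
    consider "t < r1 \<or> r2 < t" | "t = r1 \<or> t = r2" | "r1 < t" "t < r2" by linarith
    then have "(t \<in> I \<and> f t < 0 \<longleftrightarrow> r1 < t \<and> t < r2) \<and> (t \<in> I \<and> f t = 0 \<longleftrightarrow> t = r1 \<or> t = r2)"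
    proof cases
      case 1
      then show ?thesis using outside[of t] strict by auto
    next
      case 2
      then show ?thesis using r rI strict by auto
    next
      case 3
      then show ?thesis using inside[of t] mem[OF rI, of t] by simp
    qed
    then show "t \<in> I \<and> f t < 0 \<longleftrightarrow> r1 < t \<and> t < r2" "t \<in> I \<and> f t = 0 \<longleftrightarrow> t = r1 \<or> t = r2"
      by blast+
  qed
  then have "{t\<in>I. f t < 0} = {r1<..<r2}" "{s \<in> I. f s = 0} = {r1, r2}"
    by (simp_all add: set_eq_iff)
  then show thesis
    using strict by (intro that) (simp_all add: two_roots_on_def)
qed

text \<open>The sublevel set in \<open>I\<close> is the open interval between the roots, and its
  intersection with \<open>{a..b}\<close> has width \<open>min b t2 - max a t1\<close>. Positivity
  at \<open>p\<close> and \<open>q\<close> guarantees a root on each side of any negative point of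
  \<open>{a..b}\<close>. Both \<open>I = {a..b}\<close> and \<open>I = UNIV\<close> are used
  later.\<close>

lemma long_neg_iff_two_roots:
  fixes f :: "real \<Rightarrow> real"
  assumes convex: "convex_on I f" and cont: "continuous_on I f" and sub: "{a..b} \<subseteq> I"
    and I: "p \<in> I" "q \<in> I" and "p \<le> a" "b \<le> q" "f p > 0" "f q > 0" and "0 \<le> x"
  shows "long_neg f a b x \<longleftrightarrow>
    (\<exists>t1 t2. two_roots_on f I t1 t2 \<and> min b t2 - max a t1 > x) \<and> neg_min_on f I"
proof (intro iffI conjI)
  assume "long_neg f a b x"
  then obtain u v where uv: "u \<in> {a..b}" "v \<in> {a..b}" "u + x < v" "f u < 0" "f v < 0"
    unfolding long_neg_def by blast
  then have "u \<in> I" "v \<in> I" using sub by auto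
  have pq: "p < u" "u < q"
    using uv assms by (auto simp: order_less_le)
  obtain r1 r2 where r: "p < r1" "r2 < q" "two_roots_on f I r1 r2" "{t\<in>I. f t < 0} = {r1<..<r2}"
    by (rule convex_on_two_roots[OF convex cont I(1) \<open>u \<in> I\<close> I(2) pq \<open>f p > 0\<close> uv(4) \<open>f q > 0\<close>])
  have "u \<in> {r1<..<r2}" "v \<in> {r1<..<r2}"
    using uv \<open>u \<in> I\<close> \<open>v \<in> I\<close> unfolding r(4)[symmetric] by auto
  then have "min b r2 - max a r1 > x" using uv by auto
  then show "\<exists>t1 t2. two_roots_on f I t1 t2 \<and> min b t2 - max a t1 > x" using r by blast
  \<comment> \<open>\<open>I\<close> may be unbounded, so the minimum is taken over the compact
    interval between the roots; it is global because \<open>f\<close> is nonnegative elsewhere on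
    \<open>I\<close>.\<close>
  have "{r1..r2} \<subseteq> I"
    using r(3) convex_real_between[OF convex_on_imp_convex[OF convex], of r1 r2]
    by (fastforce simp: two_roots_on_def)
  then have "continuous_on {r1..r2} f" using continuous_on_subset[OF cont] by blast
  moreover have "{r1..r2} \<noteq> {}" using \<open>u \<in> {r1<..<r2}\<close> by auto
  ultimately obtain s where s: "s \<in> {r1..r2}" "\<And>t. t \<in> {r1..r2} \<Longrightarrow> f s \<le> f t"
    using continuous_attains_inf[of "{r1..r2}" f] by auto
  have neg: "f s < 0" using s(2)[of u] \<open>u \<in> {r1<..<r2}\<close> uv by auto
  have "f s \<le> f t" if "t \<in> I" for t
  proof (cases "f t < 0")
    case True
    then have "t \<in> {r1<..<r2}" using that unfolding r(4)[symmetric] by simp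
    then show ?thesis using s(2)[of t] by simp
  qed (use neg in simp)
  then show "neg_min_on f I"
    using neg s \<open>{r1..r2} \<subseteq> I\<close>
    by (auto simp: neg_min_on_def is_arg_min_def not_less intro!: exI[of _ s])
next
  assume "(\<exists>t1 t2. two_roots_on f I t1 t2 \<and> min b t2 - max a t1 > x) \<and> neg_min_on f I"
  then obtain t1 t2 s where t: "two_roots_on f I t1 t2" "min b t2 - max a t1 > x"
    and s: "s \<in> I" "f s < 0"
    by (auto simp: neg_min_on_def is_arg_min_def)
  have tI: "t1 \<in> I" "t2 \<in> I" "f t1 = 0" "f t2 = 0" "t1 < t2"
    using t(1) by (auto simp: two_roots_on_def)
  \<comment> \<open>Otherwise one root lies between the other root and \<open>s\<close>, and
    convexity makes \<open>f\<close> negative there.\<close>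
  have between: "t1 < s \<and> s < t2"
  proof (rule ccontr)
    assume "\<not> ?thesis"
    then have "f t1 < 0 \<or> f t2 < 0"
      using convex_on_neg_segment[OF convex tI(1) s(1), of t2]
        convex_on_neg_segment[OF convex tI(2) s(1), of t1] s tI
      by (cases "s = t1"; cases "s = t2") (auto simp: closed_segment_eq_real_ivl)
    then show False using tI by simp
  qed
  have neg: "f t < 0" if "t1 < t" "t < t2" for t
    using convex_on_neg_segment[OF convex tI(1) s(1), of t]
      convex_on_neg_segment[OF convex tI(2) s(1), of t] s tI that between
    by (cases "t \<le> s") (auto simp: closed_segment_eq_real_ivl)
  \<comment> \<open>A third of the excess over \<open>x\<close>: pulling both ends in by
    \<open>w\<close> leaves a distance of \<open>x + w\<close> and two points strictly between the
    roots.\<close>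
  define w where "w = (min b t2 - max a t1 - x) / 3"
  have "w > 0" "3 * w = min b t2 - max a t1 - x" using t by (auto simp: w_def)
  then show "long_neg f a b x"
    unfolding long_neg_def using \<open>0 \<le> x\<close>
    by (intro bexI[of _ "max a t1 + w"] bexI[of _ "min b t2 - w"] conjI neg) auto
qed

section \<open>One-sided derivatives of convex functions\<close>

text \<open>Difference quotients from \<open>p\<close> do not exceed the slope to the farther point
  \<open>t\<close>, and \<open>d\<close> is their limit as the nearer point tends to
  \<open>p\<close>.\<close>

lemma convex_right_derivative_le_slope:
  fixes f :: "real \<Rightarrow> real"
  assumes "convex_on I f" "p \<in> I" "t \<in> I" "p < t" "(f has_real_derivative d) (at_right p)"
  shows "d \<le> (f t - f p) / (t - p)"
proof -
  have "((\<lambda>y. (f y - f p) / (y - p)) \<longlongrightarrow> d) (at_right p)"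
    using assms(5) by (simp add: has_field_derivative_iff)
  moreover have "(f y - f p) / (y - p) \<le> (f t - f p) / (t - p)" if "p < y" "y < t" for y
    using convex_on_real_combination[OF assms(1-3) that] that by (simp add: field_simps)
  then have "\<forall>\<^sub>F y in at_right p. (f y - f p) / (y - p) \<le> (f t - f p) / (t - p)"
    using assms(4) by (auto simp: eventually_at_right_field)
  ultimately show ?thesis
    by (intro tendsto_upperbound) auto
qed

lemma convex_left_derivative_ge_slope:
  fixes f :: "real \<Rightarrow> real"
  assumes "convex_on I f" "t \<in> I" "q \<in> I" "t < q" "(f has_real_derivative d) (at_left q)"
  shows "(f q - f t) / (q - t) \<le> d"
proof -
  have "((\<lambda>y. (f y - f q) / (y - q)) \<longlongrightarrow> d) (at_left q)"
    using assms(5) by (simp add: has_field_derivative_iff)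
  moreover have "(f q - f t) / (q - t) \<le> (f y - f q) / (y - q)" if "t < y" "y < q" for y
    using convex_on_real_combination[OF assms(1-3) that] that by (simp add: field_simps)
  then have "\<forall>\<^sub>F y in at_left q. (f q - f t) / (q - t) \<le> (f y - f q) / (y - q)"
    using assms(4) by (auto simp: eventually_at_left_field)
  ultimately show ?thesis
    by (intro tendsto_lowerbound) auto
qed

text \<open>The sign of \<open>d\<close> makes \<open>p\<close> a minimum over the points of
  \<open>I\<close> to its right. In the convexity inequality at \<open>u\<close> between
  \<open>p\<close> and \<open>v\<close>, replacing \<open>f p\<close> by the larger
  \<open>f u\<close> leaves \<open>f u \<le> f v\<close>.\<close>

lemma convex_mono_right:
  fixes f :: "real \<Rightarrow> real"
  assumes "convex_on I f" "(f has_real_derivative d) (at_right p)" "0 \<le> d"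
    and "p \<in> I" "u \<in> I" "v \<in> I" "p \<le> u" "u \<le> v"
  shows "f u \<le> f v"
proof -
  have ge: "f p \<le> f t" if "t \<in> I" "p < t" for t
  proof -
    have "0 \<le> (f t - f p) / (t - p)"
      using convex_right_derivative_le_slope[OF assms(1,4) that assms(2)] assms(3) by linarith
    then show ?thesis using that by (simp add: zero_le_divide_iff)
  qed
  show ?thesis
  proof (cases "p < u \<and> u < v")
    case True
    then have "(v - p) * f u \<le> (v - u) * f p + (u - p) * f v"
      using convex_on_real_combination[OF assms(1,4,6)] by blast
    also have "\<dots> \<le> (v - u) * f u + (u - p) * f v"
      using True ge[OF assms(5)] by (intro add_right_mono mult_left_mono) auto
    finally have "(u - p) * f u \<le> (u - p) * f v" by (simp add: algebra_simps)
    then show ?thesis using True by simp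
  next
    case False
    then show ?thesis using assms ge[of v] by (cases "u = v") (auto simp: order_le_less)
  qed
qed

lemma convex_antimono_left:
  fixes f :: "real \<Rightarrow> real"
  assumes "convex_on I f" "(f has_real_derivative d) (at_left q)" "d \<le> 0"
    and "u \<in> I" "v \<in> I" "q \<in> I" "u \<le> v" "v \<le> q"
  shows "f v \<le> f u"
proof -
  have ge: "f q \<le> f t" if "t \<in> I" "t < q" for t
  proof -
    have "(f q - f t) / (q - t) \<le> 0"
      using convex_left_derivative_ge_slope[OF assms(1) that(1) assms(6) that(2) assms(2)] assms(3)
      by linarith
    then show ?thesis using that by (simp add: divide_le_0_iff)
  qed
  show ?thesis
  proof (cases "u < v \<and> v < q")
    case True
    then have "(q - u) * f v \<le> (q - v) * f u + (v - u) * f q"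
      using convex_on_real_combination[OF assms(1,4,6)] by blast
    also have "\<dots> \<le> (q - v) * f u + (v - u) * f v"
      using True ge[OF assms(5)] by (intro add_left_mono mult_left_mono) auto
    finally have "(q - v) * f v \<le> (q - v) * f u" by (simp add: algebra_simps)
    then show ?thesis using True by simp
  next
    case False
    then show ?thesis using assms ge[of u] by (cases "u = v") (auto simp: order_le_less)
  qed
qed

section \<open>Positive values of a convex function far out on the line\<close>

lemma convex_on_reflect:
  fixes f :: "real \<Rightarrow> real"
  assumes "convex_on UNIV f"
  shows "convex_on UNIV (\<lambda>t. f (- t))"
proof (rule convex_onI)
  fix t x y :: real
  assume "0 < t" "t < 1"
  then have "f ((1 - t) *\<^sub>R (- x) + t *\<^sub>R (- y)) \<le> (1 - t) * f (- x) + t * f (- y)"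
    using convex_onD[OF assms, of t "- x" "- y"] by simp
  moreover have "- ((1 - t) *\<^sub>R x + t *\<^sub>R y) = (1 - t) *\<^sub>R (- x) + t *\<^sub>R (- y)"
    by simp
  ultimately show "f (- ((1 - t) *\<^sub>R x + t *\<^sub>R y)) \<le> (1 - t) * f (- x) + t * f (- y)"
    by (simp only:)
qed simp

text \<open>To the left of \<open>u\<close> a convex function lies above the line through its values
  at \<open>u\<close> and \<open>v\<close>, and that line rises without bound towards the
  left.\<close>

lemma convex_on_unbounded_left:
  fixes f :: "real \<Rightarrow> real"
  assumes "convex_on UNIV f" "u < v" "f v < f u"
  obtains p where "p \<le> u" "f p > 0"
proof
  \<comment> \<open>The point where the line through \<open>(u, f u)\<close> and
    \<open>(v, f v)\<close> takes the value \<open>f u + \<bar>f u\<bar> + 1\<close>, which is at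
    least 1.\<close>
  define p where "p = u - (\<bar>f u\<bar> + 1) * (v - u) / (f u - f v)"
  have "(\<bar>f u\<bar> + 1) * (v - u) / (f u - f v) > 0"
    using assms by (intro divide_pos_pos mult_pos_pos) auto
  then have "p < u" by (simp add: p_def)
  then show "p \<le> u" by simp
  have eq: "(u - p) * (f u - f v) = (\<bar>f u\<bar> + 1) * (v - u)"
    using assms by (simp add: p_def)
  have "(v - p) * f u \<le> (v - u) * f p + (u - p) * f v"
    using convex_on_real_combination[OF assms(1) _ _ \<open>p < u\<close> \<open>u < v\<close>] by simp
  then have "(v - u) * f u + (u - p) * (f u - f v) \<le> (v - u) * f p"
    by (simp add: algebra_simps)
  then have "(v - u) * (f u + \<bar>f u\<bar> + 1) \<le> (v - u) * f p"
    unfolding eq by (simp add: algebra_simps)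
  then have "f u + \<bar>f u\<bar> + 1 \<le> f p" using assms by simp
  then show "f p > 0" by linarith
qed

lemma convex_on_unbounded_right:
  fixes f :: "real \<Rightarrow> real"
  assumes "convex_on UNIV f" "u < v" "f u < f v"
  obtains q where "v \<le> q" "f q > 0"
proof -
  have "convex_on UNIV (\<lambda>t. f (- t))"
    by (rule convex_on_reflect[OF assms(1)])
  then obtain p where "p \<le> - v" "f (- p) > 0"
    using convex_on_unbounded_left[of "\<lambda>t. f (- t)" "- v" "- u"] assms by auto
  then show thesis using that[of "- p"] by simp
qed

section \<open>Reduction to the sign at one point\<close>

lemma long_neg_reflect: "long_neg (\<lambda>t. f (- t)) (- b) (- a) x \<longleftrightarrow> long_neg f a b x"
proof -
  have "long_neg f a b x" if "long_neg (\<lambda>t. f (- t)) (- b) (- a) x" for f a b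
  proof -
    obtain u v where "u \<in> {-b..-a}" "v \<in> {-b..-a}" "u + x < v" "f (- u) < 0" "f (- v) < 0"
      using \<open>long_neg (\<lambda>t. f (- t)) (- b) (- a) x\<close> unfolding long_neg_def by blast
    then show ?thesis unfolding long_neg_def
      by (intro bexI[of _ "- v"] bexI[of _ "- u"]) auto
  qed
  \<comment> \<open>Reflection is an involution, so the one implication, applied also to the
    reflected data, gives both directions.\<close>
  from this[of f b a] this[of "\<lambda>t. f (- t)" "- a" "- b"] show ?thesis by auto
qed

text \<open>The points \<open>a\<close> and \<open>a + x\<close> are exactly \<open>x\<close> apart,
  whereas a strictly larger distance is required. Continuity keeps \<open>f\<close> negative
  slightly beyond \<open>a + x\<close>, and \<open>x < b - a\<close> leaves room for such a
  point.\<close>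

lemma long_neg_leftI:
  fixes f :: "real \<Rightarrow> real"
  assumes "continuous_on {a..b} f" "0 \<le> x" "x < b - a" "f a < 0" "f (a + x) < 0"
  shows "long_neg f a b x"
proof -
  have "\<exists>d>0. \<forall>v\<in>{a..b}. dist v (a + x) < d \<longrightarrow> dist (f v) (f (a + x)) < - f (a + x)"
    using assms(1)[unfolded continuous_on_iff, rule_format, of "a + x" "- f (a + x)"] assms(2-5)
    by simp
  then obtain d where d: "d > 0"
    "\<And>v. v \<in> {a..b} \<Longrightarrow> dist v (a + x) < d \<Longrightarrow> dist (f v) (f (a + x)) < - f (a + x)"
    by blast
  \<comment> \<open>The first argument of the minimum keeps \<open>v\<close> within the continuity
    radius \<open>d\<close>, the second keeps it at most \<open>b\<close>.\<close>
  define v where "v = a + x + min (d / 2) (b - a - x)"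
  have v: "v \<in> {a..b}" "a + x < v" "dist v (a + x) < d"
    using d(1) assms by (auto simp: v_def dist_real_def)
  then have "f v < 0" using d(2)[of v] by (auto simp: dist_real_def)
  then show ?thesis unfolding long_neg_def
    using v assms by (intro bexI[of _ a] bexI[of _ v]) auto
qed

lemma long_neg_rightI:
  fixes f :: "real \<Rightarrow> real"
  assumes "continuous_on {a..b} f" "0 \<le> x" "x < b - a" "f b < 0" "f (b - x) < 0"
  shows "long_neg f a b x"
proof -
  have "continuous_on {-b..-a} (\<lambda>t. f (- t))"
    by (intro continuous_on_compose2[OF assms(1)] continuous_intros) auto
  then have "long_neg (\<lambda>t. f (- t)) (- b) (- a) x"
    using assms by (intro long_neg_leftI) auto
  then show ?thesis by (simp only: long_neg_reflect)
qed

text \<open>With zeros at the endpoints excluded, each of the four sign patterns activates at most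
  one summand. A single negative endpoint makes the sublevel set an interval starting there, so the
  point at distance \<open>x\<close> from it decides. The identity is one of indicators, ready for
  taking expectations.\<close>

lemma long_neg_cases:
  fixes f :: "real \<Rightarrow> real"
  assumes convex: "convex_on {a..b} f" and cont: "continuous_on {a..b} f"
    and x: "0 \<le> x" "x < b - a" and "f a \<noteq> 0" "f b \<noteq> 0"
  shows "of_bool (long_neg f a b x) =
    (of_bool (f a < 0 \<and> f b < 0) + of_bool (f a > 0 \<and> f b > 0 \<and> long_neg f a b x)
     + of_bool (f a \<le> 0 \<and> f (a + x) < 0 \<and> f b > 0)
     + of_bool (f a > 0 \<and> f (b - x) < 0 \<and> f b \<le> 0) :: real)"
proof -
  have ab: "a \<in> {a..b}" "b \<in> {a..b}" using x by auto
  have both: "long_neg f a b x" if "f a < 0" "f b < 0"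
    unfolding long_neg_def using that ab x by (intro bexI[of _ a] bexI[of _ b]) auto
  have left: "f (a + x) < 0" if "long_neg f a b x" "f a < 0"
  proof -
    obtain u v where "u \<in> {a..b}" "v \<in> {a..b}" "u + x < v" "f v < 0"
      using \<open>long_neg f a b x\<close> unfolding long_neg_def by blast
    \<comment> \<open>The segment lemma excludes its first endpoint, so \<open>x = 0\<close>, where
      \<open>a + x\<close> is \<open>a\<close> itself, is treated apart.\<close>
    then show ?thesis
      using convex_on_neg_segment[OF convex ab(1), of v "a + x"] \<open>f a < 0\<close> x
      by (cases "x = 0") (auto simp: closed_segment_eq_real_ivl)
  qed
  have right: "f (b - x) < 0" if "long_neg f a b x" "f b < 0"
  proof -
    obtain u v where "u \<in> {a..b}" "v \<in> {a..b}" "u + x < v" "f u < 0"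
      using \<open>long_neg f a b x\<close> unfolding long_neg_def by blast
    then show ?thesis
      using convex_on_neg_segment[OF convex ab(2), of u "b - x"] \<open>f b < 0\<close> x
      by (cases "x = 0") (auto simp: closed_segment_eq_real_ivl)
  qed
  have L: "long_neg f a b x \<longleftrightarrow> f (a + x) < 0" if "f a < 0"
    using left long_neg_leftI[OF cont x] that by blast
  have R: "long_neg f a b x \<longleftrightarrow> f (b - x) < 0" if "f b < 0"
    using right long_neg_rightI[OF cont x] that by blast
  consider "f a < 0" "f b < 0" | "f a < 0" "f b > 0" | "f a > 0" "f b < 0" | "f a > 0" "f b > 0"
    using assms(5,6) by linarith
  then show ?thesis
    by cases (simp_all add: both L R)
qed

text \<open>For an increasing function the leftmost pair is the best one, and negativity at
  \<open>a + x\<close> already implies negativity at \<open>a\<close>.\<close>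

lemma long_neg_increasing:
  fixes f :: "real \<Rightarrow> real"
  assumes "continuous_on {a..b} f" "0 \<le> x" "x < b - a" "mono_on {a..b} f"
  shows "long_neg f a b x \<longleftrightarrow> f (a + x) < 0"
proof
  assume "long_neg f a b x"
  then obtain u v where "u \<in> {a..b}" "v \<in> {a..b}" "u + x < v" "f v < 0"
    unfolding long_neg_def by blast
  moreover from this have "f (a + x) \<le> f v"
    using assms by (intro mono_onD[OF assms(4)]) auto
  ultimately show "f (a + x) < 0" by simp
next
  assume "f (a + x) < 0"
  moreover have "f a \<le> f (a + x)"
    using assms by (intro mono_onD[OF assms(4)]) auto
  ultimately show "long_neg f a b x"
    using assms by (intro long_neg_leftI) auto
qed

lemma long_neg_decreasing:
  fixes f :: "real \<Rightarrow> real"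
  assumes "continuous_on {a..b} f" "0 \<le> x" "x < b - a"
    and "\<And>u v. u \<in> {a..b} \<Longrightarrow> v \<in> {a..b} \<Longrightarrow> u \<le> v \<Longrightarrow> f v \<le> f u"
  shows "long_neg f a b x \<longleftrightarrow> f (b - x) < 0"
proof -
  have "continuous_on {-b..-a} (\<lambda>t. f (- t))"
    by (intro continuous_on_compose2[OF assms(1)] continuous_intros) auto
  moreover have "mono_on {-b..-a} (\<lambda>t. f (- t))"
    by (auto intro!: mono_onI assms(4))
  ultimately show ?thesis
    using long_neg_increasing[of "-b" "-a" "\<lambda>t. f (- t)" x] assms(2,3)
    by (simp add: long_neg_reflect)
qed

section \<open>The drifted parabola and its probabilities\<close>

lemma convex_on_fN:
  assumes "convex_on I (\<lambda>t. h t + t\<^sup>2)"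
  shows "convex_on I (fN h y z)"
proof -
  have "convex_on I (\<lambda>t. z - sqrt 2 * y * t)"
    using convex_on_imp_convex[OF assms]
    by (intro convex_onI) (auto simp: algebra_simps)
  from convex_on_add[OF assms this] show ?thesis
    by (simp add: fN_def[abs_def] algebra_simps)
qed

lemma continuous_on_fN:
  assumes "continuous_on I (\<lambda>t. h t + t\<^sup>2)"
  shows "continuous_on I (fN h y z)"
  unfolding fN_def[abs_def] by (intro continuous_intros assms)

lemma has_real_derivative_fN:
  assumes "(h has_real_derivative d) (at p within S)"
  shows "(fN h y z has_real_derivative (d + 2 * p - sqrt 2 * y)) (at p within S)"
  unfolding fN_def[abs_def] using assms by (auto intro!: derivative_eq_intros)

text \<open>At fixed \<open>t\<close> the value is affine in the pair, whose first component is the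
  level \<open>z\<close> and second the realisation; measurability of \<open>h\<close> does not
  enter.\<close>

lemma measurable_fN [measurable]:
  "(\<lambda>p. fN h (snd p) (fst p) t) \<in> borel_measurable (borel \<Otimes>\<^sub>M borel)"
  unfolding fN_def by measurable

lemma measurable_long_neg_fN:
  assumes "convex_on {a..b} (\<lambda>t. h t + t\<^sup>2)" "0 \<le> x"
  shows "Measurable.pred (borel \<Otimes>\<^sub>M borel) (\<lambda>p. long_neg (fN h (snd p) (fst p)) a b x)"
  unfolding long_neg_iff_rational[OF convex_on_fN[OF assms(1)] assms(2)]
  by (rule measurable_pred_countable(2)[OF countable_rat])+ measurable

lemma PB2_eq_long_neg:
  assumes convex: "convex_on {a..b} (\<lambda>t. h t + t\<^sup>2)" and cont: "continuous_on {a..b} (\<lambda>t. h t + t\<^sup>2)"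
    and "0 \<le> x"
  shows "PB2 M N h x {a..b} =
    (\<integral>\<^sup>+ z. ennreal (exp z * \<P>(\<omega> in M. long_neg (fN h (N \<omega>) z) a b x)) \<partial>lborel)"
proof -
  have "(\<integral>\<^sup>+ t\<in>{a..b}. indicator {u. sqrt 2 * y * u - u\<^sup>2 - h u - z > 0} t \<partial>lborel) =
    emeasure lborel {t\<in>{a..b}. fN h y z t < 0}" for y z
  proof -
    have "(\<integral>\<^sup>+ t\<in>{a..b}. indicator {u. sqrt 2 * y * u - u\<^sup>2 - h u - z > 0} t \<partial>lborel) =
      (\<integral>\<^sup>+ t. indicator {t\<in>{a..b}. fN h y z t < 0} t \<partial>lborel)"
      by (intro nn_integral_cong) (auto simp: fN_def indicator_def)
    then show ?thesis
      using sublevel_measurable[OF continuous_on_fN[OF cont]] by simp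
  qed
  then show ?thesis
    using sojourn_gt_iff_long_neg[OF convex_on_fN[OF convex] continuous_on_fN[OF cont] \<open>0 \<le> x\<close>]
    by (simp add: PB2_def)
qed

text \<open>Pull the predicate back along \<open>(z, \<omega>) \<mapsto> (z, N \<omega>)\<close>;
  the measure of its sections is then measurable in \<open>z\<close>, as additivity of the outer
  integral demands.\<close>

lemma measurable_prob_comp:
  fixes N :: "'w \<Rightarrow> real"
  assumes "prob_space M" and [measurable]: "N \<in> borel_measurable M"
    and Q: "Measurable.pred (borel \<Otimes>\<^sub>M borel) (\<lambda>p. Q (fst p) (snd p))"
  shows "(\<lambda>z. \<P>(\<omega> in M. Q z (N \<omega>))) \<in> borel_measurable (borel :: real measure)"
proof -
  interpret prob_space M by fact
  have [measurable]: "Measurable.pred (borel \<Otimes>\<^sub>M M) (\<lambda>p. Q (fst p) (N (snd p)))"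
    using measurable_compose[of "\<lambda>p. (fst p, N (snd p))" "borel \<Otimes>\<^sub>M M", OF _ Q] by simp
  have "(\<lambda>z. emeasure M {\<omega> \<in> space M. Q z (N \<omega>)}) \<in> borel_measurable borel"
    by (rule measurable_emeasure) (auto simp: space_pair_measure)
  then show ?thesis unfolding measure_def by measurable
qed

text \<open>Probabilities are expectations of indicators, so an almost sure indicator identity turns
  into an identity of probabilities; disjointness of the four events is encoded in it. The grouping
  in pairs is that of the two outer integrals in the formulas.\<close>

lemma nn_integral_prob_split:
  fixes N :: "'w \<Rightarrow> real" and w :: "real \<Rightarrow> real"
  assumes M: "prob_space M" and N [measurable]: "N \<in> borel_measurable M"
    and w [measurable]: "w \<in> borel_measurable borel" and w0: "\<And>z. 0 \<le> w z"
    and A: "Measurable.pred (borel \<Otimes>\<^sub>M borel) (\<lambda>p. A (fst p) (snd p))"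
    and B1: "Measurable.pred (borel \<Otimes>\<^sub>M borel) (\<lambda>p. B1 (fst p) (snd p))"
    and B2: "Measurable.pred (borel \<Otimes>\<^sub>M borel) (\<lambda>p. B2 (fst p) (snd p))"
    and B3: "Measurable.pred (borel \<Otimes>\<^sub>M borel) (\<lambda>p. B3 (fst p) (snd p))"
    and B4: "Measurable.pred (borel \<Otimes>\<^sub>M borel) (\<lambda>p. B4 (fst p) (snd p))"
    and split: "AE z in lborel. AE \<omega> in M. of_bool (A z (N \<omega>)) =
      (of_bool (B1 z (N \<omega>)) + of_bool (B2 z (N \<omega>)) + of_bool (B3 z (N \<omega>)) + of_bool (B4 z (N \<omega>)) :: real)"
  shows "(\<integral>\<^sup>+ z. ennreal (w z * \<P>(\<omega> in M. A z (N \<omega>))) \<partial>lborel) =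
    (\<integral>\<^sup>+ z. ennreal (w z * (\<P>(\<omega> in M. B1 z (N \<omega>)) + \<P>(\<omega> in M. B2 z (N \<omega>)))) \<partial>lborel) +
    (\<integral>\<^sup>+ z. ennreal (w z * (\<P>(\<omega> in M. B3 z (N \<omega>)) + \<P>(\<omega> in M. B4 z (N \<omega>)))) \<partial>lborel)"
proof -
  interpret prob_space M by fact
  have ev: "Measurable.pred M (\<lambda>\<omega>. Q z (N \<omega>))"
    if "Measurable.pred (borel \<Otimes>\<^sub>M borel) (\<lambda>p. Q (fst p) (snd p))" for Q and z :: real
    using measurable_compose[of "\<lambda>\<omega>. (z, N \<omega>)" M, OF _ that] by simp
  have prob: "\<P>(\<omega> in M. Q z (N \<omega>)) = (\<integral>\<omega>. of_bool (Q z (N \<omega>)) \<partial>M)"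
    "integrable M (\<lambda>\<omega>. of_bool (Q z (N \<omega>)) :: real)"
    if "Measurable.pred (borel \<Otimes>\<^sub>M borel) (\<lambda>p. Q (fst p) (snd p))" for Q and z :: real
  proof -
    note [measurable] = ev[OF that, of z]
    have "\<P>(\<omega> in M. Q z (N \<omega>)) = (\<integral>\<omega>. indicator {\<omega> \<in> space M. Q z (N \<omega>)} \<omega> \<partial>M)"
      by simp
    also have "\<dots> = (\<integral>\<omega>. of_bool (Q z (N \<omega>)) \<partial>M)"
      by (intro Bochner_Integration.integral_cong) (auto simp: indicator_def)
    finally show "\<P>(\<omega> in M. Q z (N \<omega>)) = (\<integral>\<omega>. of_bool (Q z (N \<omega>)) \<partial>M)" .
    show "integrable M (\<lambda>\<omega>. of_bool (Q z (N \<omega>)) :: real)"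
      by (rule integrable_const_bound[of _ 1]) auto
  qed
  have "AE z in lborel. \<P>(\<omega> in M. A z (N \<omega>)) =
    (\<P>(\<omega> in M. B1 z (N \<omega>)) + \<P>(\<omega> in M. B2 z (N \<omega>))) + (\<P>(\<omega> in M. B3 z (N \<omega>)) + \<P>(\<omega> in M. B4 z (N \<omega>)))"
    using split
  proof eventually_elim
    case (elim z)
    note int = prob(2)[OF A, of z] prob(2)[OF B1, of z] prob(2)[OF B2, of z]
      prob(2)[OF B3, of z] prob(2)[OF B4, of z]
    have "\<P>(\<omega> in M. A z (N \<omega>)) = (\<integral>\<omega>. of_bool (B1 z (N \<omega>)) + of_bool (B2 z (N \<omega>))
        + of_bool (B3 z (N \<omega>)) + of_bool (B4 z (N \<omega>)) \<partial>M)"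
      unfolding prob(1)[OF A]
      by (rule integral_cong_AE) (use elim int in \<open>auto intro: borel_measurable_integrable\<close>)
    then show ?case
      using int by (simp add: prob(1)[OF B1] prob(1)[OF B2] prob(1)[OF B3] prob(1)[OF B4])
  qed
  then have "(\<integral>\<^sup>+ z. ennreal (w z * \<P>(\<omega> in M. A z (N \<omega>))) \<partial>lborel) =
    (\<integral>\<^sup>+ z. ennreal (w z * (\<P>(\<omega> in M. B1 z (N \<omega>)) + \<P>(\<omega> in M. B2 z (N \<omega>)))) +
      ennreal (w z * (\<P>(\<omega> in M. B3 z (N \<omega>)) + \<P>(\<omega> in M. B4 z (N \<omega>)))) \<partial>lborel)"
    by (intro nn_integral_cong_AE)
      (auto simp: w0 distrib_left ennreal_plus[symmetric] simp del: ennreal_plus elim!: eventually_mono)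
  also have "\<dots> = (\<integral>\<^sup>+ z. ennreal (w z * (\<P>(\<omega> in M. B1 z (N \<omega>)) + \<P>(\<omega> in M. B2 z (N \<omega>)))) \<partial>lborel) +
    (\<integral>\<^sup>+ z. ennreal (w z * (\<P>(\<omega> in M. B3 z (N \<omega>)) + \<P>(\<omega> in M. B4 z (N \<omega>)))) \<partial>lborel)"
  proof -
    note [measurable] = B1[THEN measurable_prob_comp[OF M N]] B2[THEN measurable_prob_comp[OF M N]]
      B3[THEN measurable_prob_comp[OF M N]] B4[THEN measurable_prob_comp[OF M N]]
    show ?thesis by (intro nn_integral_add) measurable
  qed
  finally show ?thesis .
qed

text \<open>A law with a Lebesgue density has no atoms.\<close>

lemma distributed_lborel_AE_neq:
  fixes N :: "'w \<Rightarrow> real"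
  assumes "distributed M lborel N d"
  shows "AE \<omega> in M. N \<omega> \<noteq> c"
proof -
  have [measurable]: "N \<in> measurable M lborel" "d \<in> borel_measurable lborel"
    using assms by (auto simp: distributed_def)
  have "AE y in density lborel d. y \<noteq> c"
    using AE_lborel_singleton[of c] by (auto simp: AE_density)
  then have "AE y in distr M lborel N. y \<noteq> c"
    unfolding distributed_distr_eq_density[OF assms] .
  then show ?thesis by (rule AE_distrD[rotated]) measurable
qed

text \<open>For \<open>t \<noteq> 0\<close> a zero pins \<open>N\<close> to a single value, a null
  event at every level. At \<open>t = 0\<close> the normal variable drops out, and only the one
  level \<open>z = - h 0\<close> has to be discarded.\<close>

lemma fN_AE_neq_0:
  assumes "distributed M lborel N d"
  shows "AE z in lborel. AE \<omega> in M. fN h (N \<omega>) z t \<noteq> 0"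
  using AE_lborel_singleton[of "- (h t + t\<^sup>2)"]
proof eventually_elim
  case (elim z)
  show ?case
  proof (cases "t = 0")
    case True
    then show ?thesis using elim by (simp add: fN_def)
  next
    case False
    show ?thesis
      using distributed_lborel_AE_neq[OF assms, of "(h t + t\<^sup>2 + z) / (sqrt 2 * t)"]
      by eventually_elim (use False in \<open>auto simp: fN_def field_simps\<close>)
  qed
qed

text \<open>The bound on \<open>x\<close> is strict: at \<open>x = b - a\<close> the sojourn time
  cannot exceed \<open>x\<close>, so the left-hand side vanishes while the right-hand sides are
  positive. The slope inequality concerns the convex function \<open>h t + t\<^sup>2\<close>; for
  \<open>h t = - t\<^sup>2\<close> one has \<open>da = - 2 * a > - 2 * b = db\<close>.\<close>

theorem theorem1p3:
  fixes M :: "'w measure" and N :: "'w \<Rightarrow> real" and h :: "real \<Rightarrow> real" and a b x :: real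
  assumes "prob_space M"
    and "distributed M lborel N std_normal_density"
    and "a < b" and "0 \<le> x" and "x < b - a"
  shows
    "(continuous_on {a..b} (\<lambda>t. h t + t\<^sup>2) \<and> convex_on {a..b} (\<lambda>t. h t + t\<^sup>2) \<longrightarrow>
        PB2 M N h x {a..b} =
          (\<integral>\<^sup>+ z. ennreal (exp z *
              (\<P>(\<omega> in M. fN h (N \<omega>) z a < 0 \<and> fN h (N \<omega>) z b < 0)
               + \<P>(\<omega> in M. fN h (N \<omega>) z a > 0 \<and> fN h (N \<omega>) z b > 0
                     \<and> (\<exists>s\<^sub>1 s\<^sub>2. two_roots_on (fN h (N \<omega>) z) {a..b} s\<^sub>1 s\<^sub>2 \<and> s\<^sub>2 - s\<^sub>1 > x)
                     \<and> neg_min_on (fN h (N \<omega>) z) {a..b}))) \<partial>lborel)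
        + (\<integral>\<^sup>+ z. ennreal (exp z *
              (\<P>(\<omega> in M. fN h (N \<omega>) z a \<le> 0 \<and> fN h (N \<omega>) z (a + x) < 0 \<and> fN h (N \<omega>) z b > 0)
               + \<P>(\<omega> in M. fN h (N \<omega>) z a > 0 \<and> fN h (N \<omega>) z (b - x) < 0 \<and> fN h (N \<omega>) z b \<le> 0)))
            \<partial>lborel))
     \<and>
     (\<forall>da db :: real.
        continuous_on UNIV (\<lambda>t. h t + t\<^sup>2) \<and> convex_on UNIV (\<lambda>t. h t + t\<^sup>2)
        \<and> (h has_real_derivative da) (at_right a) \<and> (h has_real_derivative db) (at_left b) \<longrightarrow>
        da + 2 * a \<le> db + 2 * b \<and>
        PB2 M N h x {a..b} =
          (\<integral>\<^sup>+ z. ennreal (exp z *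
              (\<P>(\<omega> in M. fN h (N \<omega>) z (a + x) < 0 \<and> sqrt 2 * N \<omega> \<le> da + 2 * a)
               + \<P>(\<omega> in M. fN h (N \<omega>) z (b - x) < 0 \<and> sqrt 2 * N \<omega> \<ge> db + 2 * b))) \<partial>lborel)
        + (\<integral>\<^sup>+ z. ennreal (exp z *
              \<P>(\<omega> in M. (\<exists>t\<^sub>1 t\<^sub>2. two_roots_on (fN h (N \<omega>) z) UNIV t\<^sub>1 t\<^sub>2
                             \<and> min b t\<^sub>2 - max a t\<^sub>1 > x)
                     \<and> da + 2 * a < sqrt 2 * N \<omega> \<and> sqrt 2 * N \<omega> < db + 2 * b
                     \<and> neg_min_on (fN h (N \<omega>) z) UNIV)) \<partial>lborel))"
proof (intro conjI impI allI)

  \<comment> \<open>The formula by the signs at the endpoints\<close>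
  interpret prob_space M by fact
  have N [measurable]: "N \<in> borel_measurable M"
    using assms(2) by (auto simp: distributed_def)
  assume "continuous_on {a..b} (\<lambda>t. h t + t\<^sup>2) \<and> convex_on {a..b} (\<lambda>t. h t + t\<^sup>2)"
  then have cont: "continuous_on {a..b} (\<lambda>t. h t + t\<^sup>2)"
    and convex: "convex_on {a..b} (\<lambda>t. h t + t\<^sup>2)" by auto
  note cf = convex_on_fN[OF convex] continuous_on_fN[OF cont]
  note [measurable] = measurable_long_neg_fN[OF convex \<open>0 \<le> x\<close>]
  \<comment> \<open>Both roots lie in \<open>{a..b}\<close>, so clipping them to that interval
    changes nothing; the endpoints themselves serve as the points \<open>p\<close> and
    \<open>q\<close> of positivity.\<close>
  have roots: "fN h y z a > 0 \<and> fN h y z b > 0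
      \<and> (\<exists>s\<^sub>1 s\<^sub>2. two_roots_on (fN h y z) {a..b} s\<^sub>1 s\<^sub>2 \<and> s\<^sub>2 - s\<^sub>1 > x) \<and> neg_min_on (fN h y z) {a..b}
    \<longleftrightarrow> fN h y z a > 0 \<and> fN h y z b > 0 \<and> long_neg (fN h y z) a b x" for y z
  proof -
    have *: "min b s2 - max a s1 = s2 - s1" if "two_roots_on (fN h y z) {a..b} s1 s2" for s1 s2
    proof -
      have "s1 \<in> {a..b}" "s2 \<in> {a..b}" using that by (auto simp: two_roots_on_def)
      then show ?thesis by (simp add: min_def max_def)
    qed
    then have "(\<exists>s1 s2. two_roots_on (fN h y z) {a..b} s1 s2 \<and> s2 - s1 > x) \<longleftrightarrow>
      (\<exists>s1 s2. two_roots_on (fN h y z) {a..b} s1 s2 \<and> min b s2 - max a s1 > x)"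
      by metis
    moreover have "a \<in> {a..b}" "b \<in> {a..b}" using \<open>a < b\<close> by auto
    ultimately show ?thesis
      using long_neg_iff_two_roots[OF cf(1) cf(2) order_refl, of a b y z x] \<open>0 \<le> x\<close> by blast
  qed
  \<comment> \<open>The null zeros must go: if \<open>f a < 0\<close> and \<open>f b = 0\<close>,
    for instance, no summand holds although \<open>long_neg\<close> may.\<close>
  have split: "AE z in lborel. AE \<omega> in M. of_bool (long_neg (fN h (N \<omega>) z) a b x) =
     (of_bool (fN h (N \<omega>) z a < 0 \<and> fN h (N \<omega>) z b < 0)
      + of_bool (fN h (N \<omega>) z a > 0 \<and> fN h (N \<omega>) z b > 0 \<and> long_neg (fN h (N \<omega>) z) a b x)
      + of_bool (fN h (N \<omega>) z a \<le> 0 \<and> fN h (N \<omega>) z (a + x) < 0 \<and> fN h (N \<omega>) z b > 0)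
      + of_bool (fN h (N \<omega>) z a > 0 \<and> fN h (N \<omega>) z (b - x) < 0 \<and> fN h (N \<omega>) z b \<le> 0) :: real)"
    using fN_AE_neq_0[OF assms(2), of h a] fN_AE_neq_0[OF assms(2), of h b]
  proof eventually_elim
    case (elim z)
    then show ?case
      by eventually_elim (rule long_neg_cases[OF cf \<open>0 \<le> x\<close> \<open>x < b - a\<close>])
  qed
  show "PB2 M N h x {a..b} =
          (\<integral>\<^sup>+ z. ennreal (exp z *
              (\<P>(\<omega> in M. fN h (N \<omega>) z a < 0 \<and> fN h (N \<omega>) z b < 0)
               + \<P>(\<omega> in M. fN h (N \<omega>) z a > 0 \<and> fN h (N \<omega>) z b > 0
                     \<and> (\<exists>s\<^sub>1 s\<^sub>2. two_roots_on (fN h (N \<omega>) z) {a..b} s\<^sub>1 s\<^sub>2 \<and> s\<^sub>2 - s\<^sub>1 > x)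
                     \<and> neg_min_on (fN h (N \<omega>) z) {a..b}))) \<partial>lborel)
        + (\<integral>\<^sup>+ z. ennreal (exp z *
              (\<P>(\<omega> in M. fN h (N \<omega>) z a \<le> 0 \<and> fN h (N \<omega>) z (a + x) < 0 \<and> fN h (N \<omega>) z b > 0)
               + \<P>(\<omega> in M. fN h (N \<omega>) z a > 0 \<and> fN h (N \<omega>) z (b - x) < 0 \<and> fN h (N \<omega>) z b \<le> 0)))
            \<partial>lborel)"
    \<comment> \<open>The event about roots is replaced by \<open>long_neg\<close>, whose joint
      measurability is available.\<close>
    unfolding PB2_eq_long_neg[OF convex cont \<open>0 \<le> x\<close>] roots
    by (rule nn_integral_prob_split[OF \<open>prob_space M\<close> N _ _ _ _ _ _ _ split]) (simp, simp, measurable)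
next

  \<comment> \<open>The formula by the one-sided slopes at the endpoints\<close>
  fix da db :: real
  assume asm: "continuous_on UNIV (\<lambda>t. h t + t\<^sup>2) \<and> convex_on UNIV (\<lambda>t. h t + t\<^sup>2)
    \<and> (h has_real_derivative da) (at_right a) \<and> (h has_real_derivative db) (at_left b)"
  then have da: "(h has_real_derivative da) (at_right a)"
    and db: "(h has_real_derivative db) (at_left b)" by auto
  have cont: "continuous_on I (\<lambda>t. h t + t\<^sup>2)" for I
    using asm continuous_on_subset[of UNIV _ I] by auto
  have convex: "convex_on UNIV (\<lambda>t. h t + t\<^sup>2)" using asm by blast
  then have "convex_on {a..b} (\<lambda>t. h t + t\<^sup>2)" by (rule convex_on_subset) auto
  note convex' = this
  note cf = convex_on_fN[OF convex] continuous_on_fN[OF cont]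
  note dera = has_real_derivative_fN[OF da] and derb = has_real_derivative_fN[OF db]
  \<comment> \<open>At \<open>y = 0\<close> and \<open>z = 0\<close> the function is
    \<open>h t + t\<^sup>2\<close>, and its secant slope over \<open>{a..b}\<close> lies between the
    two one-sided derivatives.\<close>
  show le: "da + 2 * a \<le> db + 2 * b"
    using convex_right_derivative_le_slope[OF cf(1) UNIV_I UNIV_I \<open>a < b\<close> dera[of 0 0]]
      convex_left_derivative_ge_slope[OF cf(1) UNIV_I UNIV_I \<open>a < b\<close> derb[of 0 0]] by simp
  interpret prob_space M by fact
  have N [measurable]: "N \<in> borel_measurable M"
    using assms(2) by (auto simp: distributed_def)
  note [measurable] = measurable_long_neg_fN[OF convex' \<open>0 \<le> x\<close>]
  \<comment> \<open>The right derivative \<open>da + 2 * a - sqrt 2 * y\<close> at \<open>a\<close>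
    is nonnegative, so the function increases on \<open>{a..b}\<close>.\<close>
  have left: "long_neg (fN h y z) a b x \<longleftrightarrow> fN h y z (a + x) < 0" if "sqrt 2 * y \<le> da + 2 * a" for y z
  proof (rule long_neg_increasing[OF cf(2) \<open>0 \<le> x\<close> \<open>x < b - a\<close>])
    show "mono_on {a..b} (fN h y z)"
      using that by (intro mono_onI convex_mono_right[OF cf(1) dera]) auto
  qed
  have right: "long_neg (fN h y z) a b x \<longleftrightarrow> fN h y z (b - x) < 0" if "sqrt 2 * y \<ge> db + 2 * b" for y z
  proof (rule long_neg_decreasing[OF cf(2) \<open>0 \<le> x\<close> \<open>x < b - a\<close>])
    show "fN h y z v \<le> fN h y z u" if "u \<in> {a..b}" "v \<in> {a..b}" "u \<le> v" for u v
      using that \<open>sqrt 2 * y \<ge> db + 2 * b\<close> by (intro convex_antimono_left[OF cf(1) derb]) auto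
  qed
  \<comment> \<open>Strict signs of the slopes at \<open>a\<close> and \<open>b\<close> give a
    decreasing chord starting at \<open>a\<close> and an increasing one ending at \<open>b\<close>.
    Extending them outward yields positive values at some \<open>p \<le> a\<close> and
    \<open>q \<ge> b\<close>, as the root lemma on \<open>UNIV\<close> requires.\<close>
  have middle: "(\<exists>t\<^sub>1 t\<^sub>2. two_roots_on (fN h y z) UNIV t\<^sub>1 t\<^sub>2 \<and> min b t\<^sub>2 - max a t\<^sub>1 > x)
      \<and> da + 2 * a < sqrt 2 * y \<and> sqrt 2 * y < db + 2 * b \<and> neg_min_on (fN h y z) UNIV
    \<longleftrightarrow> long_neg (fN h y z) a b x \<and> da + 2 * a < sqrt 2 * y \<and> sqrt 2 * y < db + 2 * b" for y z
  proof -
    have "long_neg (fN h y z) a b x \<longleftrightarrow>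
      (\<exists>t1 t2. two_roots_on (fN h y z) UNIV t1 t2 \<and> min b t2 - max a t1 > x) \<and> neg_min_on (fN h y z) UNIV"
      if c: "da + 2 * a < sqrt 2 * y" "sqrt 2 * y < db + 2 * b"
    proof -
      obtain e where e: "e > 0" "\<forall>k>0. a + k \<in> {a<..} \<longrightarrow> k < e \<longrightarrow> fN h y z a > fN h y z (a + k)"
        using has_real_derivative_neg_dec_right[OF dera[of y z]] c by auto
      have "fN h y z (a + e / 2) < fN h y z a" using e(2)[rule_format, of "e / 2"] e(1) by simp
      then obtain p where p: "p \<le> a" "fN h y z p > 0"
        using convex_on_unbounded_left[OF cf(1), of a "a + e / 2"] e(1) by auto
      obtain e' where e': "e' > 0" "\<forall>k>0. b - k \<in> {..<b} \<longrightarrow> k < e' \<longrightarrow> fN h y z (b - k) < fN h y z b"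
        using has_real_derivative_pos_inc_left[OF derb[of y z]] c by auto
      have "fN h y z (b - e' / 2) < fN h y z b" using e'(2)[rule_format, of "e' / 2"] e'(1) by simp
      then obtain q where q: "b \<le> q" "fN h y z q > 0"
        using convex_on_unbounded_right[OF cf(1), of "b - e' / 2" b] e'(1) by auto
      show ?thesis
        by (rule long_neg_iff_two_roots[OF cf subset_UNIV UNIV_I UNIV_I p(1) q(1) p(2) q(2) \<open>0 \<le> x\<close>])
    qed
    then show ?thesis by blast
  qed
  \<comment> \<open>The summand \<open>False\<close> fills the fourth slot of the splitting lemma
    and contributes probability zero.\<close>
  have split: "AE z in lborel. AE \<omega> in M. of_bool (long_neg (fN h (N \<omega>) z) a b x) =
     (of_bool (fN h (N \<omega>) z (a + x) < 0 \<and> sqrt 2 * N \<omega> \<le> da + 2 * a)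
      + of_bool (fN h (N \<omega>) z (b - x) < 0 \<and> sqrt 2 * N \<omega> \<ge> db + 2 * b)
      + of_bool (long_neg (fN h (N \<omega>) z) a b x \<and> da + 2 * a < sqrt 2 * N \<omega> \<and> sqrt 2 * N \<omega> < db + 2 * b)
      + of_bool False :: real)"
  proof (rule AE_I2)
    fix z
    show "AE \<omega> in M. of_bool (long_neg (fN h (N \<omega>) z) a b x) =
     (of_bool (fN h (N \<omega>) z (a + x) < 0 \<and> sqrt 2 * N \<omega> \<le> da + 2 * a)
      + of_bool (fN h (N \<omega>) z (b - x) < 0 \<and> sqrt 2 * N \<omega> \<ge> db + 2 * b)
      + of_bool (long_neg (fN h (N \<omega>) z) a b x \<and> da + 2 * a < sqrt 2 * N \<omega> \<and> sqrt 2 * N \<omega> < db + 2 * b)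
      + of_bool False :: real)"
      using distributed_lborel_AE_neq[OF assms(2), of "(da + 2 * a) / sqrt 2"]
    proof eventually_elim
      case (elim \<omega>)
      \<comment> \<open>The first two events meet only if \<open>da + 2 * a = db + 2 * b\<close> and
        \<open>sqrt 2 * N\<close> takes this value; without it the three cases are disjoint.\<close>
      then have "sqrt 2 * N \<omega> \<noteq> da + 2 * a" by (auto simp: field_simps)
      then consider "sqrt 2 * N \<omega> \<le> da + 2 * a" "\<not> sqrt 2 * N \<omega> \<ge> db + 2 * b"
        | "\<not> sqrt 2 * N \<omega> \<le> da + 2 * a" "sqrt 2 * N \<omega> \<ge> db + 2 * b"
        | "da + 2 * a < sqrt 2 * N \<omega>" "sqrt 2 * N \<omega> < db + 2 * b"
        using le by linarith
      then show ?case
        by cases (simp_all add: left right)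
    qed
  qed
  show "PB2 M N h x {a..b} =
          (\<integral>\<^sup>+ z. ennreal (exp z *
              (\<P>(\<omega> in M. fN h (N \<omega>) z (a + x) < 0 \<and> sqrt 2 * N \<omega> \<le> da + 2 * a)
               + \<P>(\<omega> in M. fN h (N \<omega>) z (b - x) < 0 \<and> sqrt 2 * N \<omega> \<ge> db + 2 * b))) \<partial>lborel)
        + (\<integral>\<^sup>+ z. ennreal (exp z *
              \<P>(\<omega> in M. (\<exists>t\<^sub>1 t\<^sub>2. two_roots_on (fN h (N \<omega>) z) UNIV t\<^sub>1 t\<^sub>2
                             \<and> min b t\<^sub>2 - max a t\<^sub>1 > x)
                     \<and> da + 2 * a < sqrt 2 * N \<omega> \<and> sqrt 2 * N \<omega> < db + 2 * b
                     \<and> neg_min_on (fN h (N \<omega>) z) UNIV)) \<partial>lborel)"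
  proof -
    have "(\<integral>\<^sup>+ z. ennreal (exp z * \<P>(\<omega> in M. long_neg (fN h (N \<omega>) z) a b x)) \<partial>lborel) =
          (\<integral>\<^sup>+ z. ennreal (exp z *
              (\<P>(\<omega> in M. fN h (N \<omega>) z (a + x) < 0 \<and> sqrt 2 * N \<omega> \<le> da + 2 * a)
               + \<P>(\<omega> in M. fN h (N \<omega>) z (b - x) < 0 \<and> sqrt 2 * N \<omega> \<ge> db + 2 * b))) \<partial>lborel)
        + (\<integral>\<^sup>+ z. ennreal (exp z *
              (\<P>(\<omega> in M. long_neg (fN h (N \<omega>) z) a b x \<and> da + 2 * a < sqrt 2 * N \<omega> \<and> sqrt 2 * N \<omega> < db + 2 * b)
               + \<P>(\<omega> in M. False))) \<partial>lborel)"
      by (rule nn_integral_prob_split[OF \<open>prob_space M\<close> N _ _ _ _ _ _ _ split]) (simp, simp, measurable)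
    then show ?thesis
      unfolding PB2_eq_long_neg[OF convex' cont \<open>0 \<le> x\<close>] middle by simp
  qed
qed

end
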